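(* The local function $G(\alpha,\beta;\gamma;e;x)$ can be expressed in terms of ${}_3F_2$: on a neighborhood of $x=0$, $$G(\alpha,\beta;\gamma;e;x)={}_3F_2(\alpha,\beta,e+1;\,\gamma,e;\,x).$$
   Context: The Heun equation (HE) with parameters $a\in\mathbb{C}\setminus\{0,1\}$, $q;\alpha,\beta;\gamma,\delta,\epsilon\in\mathbb{C}$, where $\epsilon=\alpha+\beta-\gamma-\delta+1$, is $$F''+\Bigl[\frac{\gamma}{x}+\frac{\delta}{x-1}+\frac{\epsilon}{x-a}\Bigr]F'+\frac{\alpha\beta x-q}{x(x-1)(x-a)}F=0 .$$ If $\gamma$ is not a nonpositive integer, $\mathrm{Hl}(a,q;\alpha,\beta;\gamma,\delta;x)$ denotes its solution analytic at $x=0$ with value $1$ there. The function $G$ is defined near $x=0$ by $G(\alpha,\beta;\gamma;e;x):=\mathrm{Hl}(a,q;\alpha,\beta;\gamma,\delta;x)$ with $\delta=\alpha+\beta-\gamma+2$ (so that $\epsilon=-1$) and $$a=\frac{e(e-\gamma+1)}{(e-\alpha)(e-\beta)},\qquad q=\alpha\beta\,\frac{(e+1)(e-\gamma+1)}{(e-\alpha)(e-\beta)}.$$ Here $\alpha,\beta,\gamma,e\in\mathbb{C}$ are such that $a$ is defined and $a\ne0,1,\infty$, and neither $\gamma$ nor $e$ is a nonpositive integer. ${}_3F_2(a_1,a_2,a_3;b_1,b_2;x)=\sum_{n\ge0}\frac{(a_1)_n(a_2)_n(a_3)_n}{(b_1)_n(b_2)_n\,n!}x^n$ for $|x|<1$,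 where $b_1,b_2$ are not nonpositive integers. *)

theory Defs
  imports "HOL-Analysis.Analysis" "HOL-Library.Nonpos_Ints"
begin

definition heun_eq_at ::
  "complex \<Rightarrow> complex \<Rightarrow> complex \<Rightarrow> complex \<Rightarrow> complex \<Rightarrow> complex \<Rightarrow> (complex \<Rightarrow> complex) \<Rightarrow> complex \<Rightarrow> bool"
where
  "heun_eq_at a q \<alpha> \<beta> \<gamma> \<delta> F x \<longleftrightarrow>
     (let \<epsilon> = \<alpha> + \<beta> - \<gamma> - \<delta> + 1 in
        deriv (deriv F) x
        + (\<gamma> / x + \<delta> / (x - 1) + \<epsilon> / (x - a)) * deriv F x
        + (\<alpha> * \<beta> * x - q) / (x * (x - 1) * (x - a)) * F x = 0)"

(* The equation has a singular point at 0, so it is required only for all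
   sufficiently small nonzero x. *)
definition heun_local_solution ::
  "complex \<Rightarrow> complex \<Rightarrow> complex \<Rightarrow> complex \<Rightarrow> complex \<Rightarrow> complex \<Rightarrow> (complex \<Rightarrow> complex) \<Rightarrow> bool"
where
  "heun_local_solution a q \<alpha> \<beta> \<gamma> \<delta> F \<longleftrightarrow>
     F analytic_on {0} \<and> F 0 = 1 \<and> (\<forall>\<^sub>F x in at 0. heun_eq_at a q \<alpha> \<beta> \<gamma> \<delta> F x)"

(* The local solution is unique only as a germ at 0, so the definite description
   ranges over Taylor series at 0.  It is meaningful when a is not 0 or 1 and gamma
   is not a nonpositive integer. *)
definition Hl ::
  "complex \<Rightarrow> complex \<Rightarrow> complex \<Rightarrow> complex \<Rightarrow> complex \<Rightarrow> complex \<Rightarrow> complex \<Rightarrow> complex"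
where
  "Hl a q \<alpha> \<beta> \<gamma> \<delta> =
     eval_fps (THE f. \<exists>F. heun_local_solution a q \<alpha> \<beta> \<gamma> \<delta> F \<and> F has_fps_expansion f)"

definition G_sing :: "complex \<Rightarrow> complex \<Rightarrow> complex \<Rightarrow> complex \<Rightarrow> complex" where
  "G_sing \<alpha> \<beta> \<gamma> e = e * (e - \<gamma> + 1) / ((e - \<alpha>) * (e - \<beta>))"

definition G_acc :: "complex \<Rightarrow> complex \<Rightarrow> complex \<Rightarrow> complex \<Rightarrow> complex" where
  "G_acc \<alpha> \<beta> \<gamma> e = \<alpha> * \<beta> * ((e + 1) * (e - \<gamma> + 1) / ((e - \<alpha>) * (e - \<beta>)))"

(* delta = alpha + beta - gamma + 2 makes epsilon = -1 *)
definition heun_G :: "complex \<Rightarrow> complex \<Rightarrow> complex \<Rightarrow> complex \<Rightarrow> complex \<Rightarrow> complex" where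
  "heun_G \<alpha> \<beta> \<gamma> e x =
     Hl (G_sing \<alpha> \<beta> \<gamma> e) (G_acc \<alpha> \<beta> \<gamma> e) \<alpha> \<beta> \<gamma> (\<alpha> + \<beta> - \<gamma> + 2) x"

definition hyp3F2 ::
  "complex \<Rightarrow> complex \<Rightarrow> complex \<Rightarrow> complex \<Rightarrow> complex \<Rightarrow> complex \<Rightarrow> complex"
where
  "hyp3F2 a1 a2 a3 b1 b2 = eval_fps (fps_hypergeo [a1, a2, a3] [b1, b2] 1)"

lemma hyp3F2_series:
  "hyp3F2 a1 a2 a3 b1 b2 x =
     (\<Sum>n. pochhammer a1 n * pochhammer a2 n * pochhammer a3 n /
           (pochhammer b1 n * pochhammer b2 n * fact n) * x ^ n)"
  by (simp add: hyp3F2_def eval_fps_def)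

end

theory Submission
  imports Defs
begin

text \<open>
  Both sides are sums of power series, so it suffices that the hypergeometric series is the power
  series singled out in the definition of \<open>Hl\<close>.  Clearing denominators turns the Heun equation into
  a three-term recurrence for the Taylor coefficients.  Since \<open>a \<noteq> 0\<close> and \<open>\<gamma>\<close> is not a nonpositive
  integer, the recurrence determines every coefficient from the constant one, which gives the
  uniqueness behind \<open>Hl\<close> (lemmas \<open>heun_fps_unique\<close> and \<open>Hl_eqI\<close>).

  It remains to see that the coefficients \<open>f n\<close> of the series \<open>3F2(\<alpha>, \<beta>, e+1; \<gamma>, e; x)\<close> satisfy this
  recurrence (lemma \<open>heun_fps_op_hypergeo_3_2\<close>).  The parameter pair \<open>e + 1\<close>, \<open>e\<close> contributes only
  the factor \<open>(e + n) / e\<close>, so \<open>f n = c n * (e + n) / e\<close> with \<open>c n\<close> the coefficients of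
  \<open>2F1(\<alpha>, \<beta>; \<gamma>; x)\<close>.  The two outer terms of the recurrence carry exactly the factors
  \<open>(\<alpha> + n) * (\<beta> + n)\<close> and \<open>(n + 1) * (\<gamma> + n)\<close> that appear in the two-term recurrence of \<open>c\<close>, so all
  three terms become multiples of the same \<open>c n\<close>.  What is left is a polynomial in \<open>n\<close> of degree at
  most three.  Its cubic coefficient cancels identically, its quadratic coefficient because
  \<open>\<epsilon> = -1\<close>; its constant coefficient vanishes by the value of \<open>q\<close>, and then its linear one by
  the value of \<open>a\<close>.
\<close>

text \<open>
  The Heun operator multiplied by \<open>x * (x - 1) * (x - a)\<close>, which makes its coefficients polynomials,
  so that it acts on formal power series at the singular point 0.
\<close>
definition heun_fps_op ::
  "complex \<Rightarrow> complex \<Rightarrow> complex \<Rightarrow> complex \<Rightarrow> complex \<Rightarrow> complex \<Rightarrow> complex fps \<Rightarrow> complex fps"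
where
  "heun_fps_op a q \<alpha> \<beta> \<gamma> \<delta> f =
     fps_X * (fps_X - 1) * (fps_X - fps_const a) * fps_deriv (fps_deriv f)
     + (fps_const \<gamma> * (fps_X - 1) * (fps_X - fps_const a)
        + fps_const \<delta> * fps_X * (fps_X - fps_const a)
        + fps_const (\<alpha> + \<beta> - \<gamma> - \<delta> + 1) * fps_X * (fps_X - 1)) * fps_deriv f
     + (fps_const (\<alpha> * \<beta>) * fps_X - fps_const q) * f"

lemma heun_eq_at_cleared:
  assumes "x \<noteq> 0" "x \<noteq> 1" "x \<noteq> a"
  shows "heun_eq_at a q \<alpha> \<beta> \<gamma> \<delta> F x \<longleftrightarrow>
     x * (x - 1) * (x - a) * deriv (deriv F) x
     + (\<gamma> * (x - 1) * (x - a) + \<delta> * x * (x - a)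
        + (\<alpha> + \<beta> - \<gamma> - \<delta> + 1) * x * (x - 1)) * deriv F x
     + (\<alpha> * \<beta> * x - q) * F x = 0" (is "_ \<longleftrightarrow> ?p = 0")
proof -
  define \<epsilon> where "\<epsilon> = \<alpha> + \<beta> - \<gamma> - \<delta> + 1"
  have nz: "x - 1 \<noteq> 0" "x - a \<noteq> 0"
    using assms by auto
  have "?p = x * (x - 1) * (x - a) *
      (deriv (deriv F) x + (\<gamma> / x + \<delta> / (x - 1) + \<epsilon> / (x - a)) * deriv F x
       + (\<alpha> * \<beta> * x - q) / (x * (x - 1) * (x - a)) * F x)"
    unfolding \<epsilon>_def[symmetric] using assms(1) nz
    by (simp add: divide_simps) (simp add: algebra_simps)
  thus ?thesis
    using assms(1) nz by (simp add: heun_eq_at_def Let_def \<epsilon>_def)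
qed

text \<open>
  Passage between the analytic equation on a punctured neighbourhood and the formal equation.  It is
  used in both directions: to see that a convergent formal solution is a local solution, and to
  constrain the coefficients of an arbitrary local solution.
\<close>
lemma eventually_heun_eq_iff_fps:
  assumes F: "F has_fps_expansion f" and a: "a \<noteq> 0"
  shows "(\<forall>\<^sub>F x in at 0. heun_eq_at a q \<alpha> \<beta> \<gamma> \<delta> F x) \<longleftrightarrow> heun_fps_op a q \<alpha> \<beta> \<gamma> \<delta> f = 0"
proof -
  let ?L = "\<lambda>x. x * (x - 1) * (x - a) * deriv (deriv F) x
     + (\<gamma> * (x - 1) * (x - a) + \<delta> * x * (x - a)
        + (\<alpha> + \<beta> - \<gamma> - \<delta> + 1) * x * (x - 1)) * deriv F x
     + (\<alpha> * \<beta> * x - q) * F x"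
  have L: "?L has_fps_expansion heun_fps_op a q \<alpha> \<beta> \<gamma> \<delta> f"
    unfolding heun_fps_op_def by (intro fps_expansion_intros F)
  have "\<forall>\<^sub>F x in at 0. x \<noteq> (0::complex) \<and> x \<noteq> 1 \<and> x \<noteq> a"
    using a by (intro eventually_conj eventually_neq_at_within) 
  hence "(\<forall>\<^sub>F x in at 0. heun_eq_at a q \<alpha> \<beta> \<gamma> \<delta> F x) \<longleftrightarrow> (\<forall>\<^sub>F x in at 0. ?L x = 0)"
    by (intro eventually_subst) (auto elim!: eventually_mono simp: heun_eq_at_cleared)
  also have "\<dots> \<longleftrightarrow> heun_fps_op a q \<alpha> \<beta> \<gamma> \<delta> f = 0"
  proof
    assume ev: "\<forall>\<^sub>F x in at 0. ?L x = 0"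
    \<comment> \<open>The origin, where the equation says nothing, is filled in by continuity.\<close>
    have "(?L \<longlongrightarrow> ?L 0) (at 0)"
      using has_fps_expansion_imp_continuous[OF L, of UNIV] unfolding continuous_within .
    moreover have "(?L \<longlongrightarrow> 0) (at 0)"
      using ev by (rule tendsto_eventually)
    ultimately have "?L 0 = 0"
      using tendsto_unique[OF trivial_limit_at] by blast
    with ev have "\<forall>\<^sub>F x in nhds 0. ?L x = 0"
      unfolding eventually_nhds_conv_at by blast
    hence "(deriv ^^ n) ?L 0 = (deriv ^^ n) (\<lambda>_. 0) 0" for n
      by (intro higher_deriv_cong_ev) auto
    thus "heun_fps_op a q \<alpha> \<beta> \<gamma> \<delta> f = 0"
      using fps_nth_fps_expansion[OF L] fps_nth_fps_expansion[OF has_fps_expansion_0]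
      by (simp add: fps_eq_iff)
  next
    assume "heun_fps_op a q \<alpha> \<beta> \<gamma> \<delta> f = 0"
    with L have "\<forall>\<^sub>F x in nhds 0. ?L x = 0"
      by (auto simp: has_fps_expansion_def elim!: eventually_mono)
    thus "\<forall>\<^sub>F x in at 0. ?L x = 0"
      by (simp add: eventually_nhds_conv_at)
  qed
  finally show ?thesis .
qed

lemma heun_fps_op_nth:
  "fps_nth (heun_fps_op a q \<alpha> \<beta> \<gamma> \<delta> f) 0 = \<gamma> * a * fps_nth f 1 - q * fps_nth f 0"
  "fps_nth (heun_fps_op a q \<alpha> \<beta> \<gamma> \<delta> f) (Suc n) =
     (\<alpha> + of_nat n) * (\<beta> + of_nat n) * fps_nth f n
     - (of_nat (Suc n) * ((\<gamma> + of_nat n) * (1 + a) + a * \<delta> + (\<alpha> + \<beta> - \<gamma> - \<delta> + 1)) + q)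
       * fps_nth f (Suc n)
     + a * of_nat (Suc (Suc n)) * (\<gamma> + of_nat (Suc n)) * fps_nth f (Suc (Suc n))"
proof -
  have expand: "heun_fps_op a q \<alpha> \<beta> \<gamma> \<delta> f =
     fps_X * (fps_X * (fps_X * fps_deriv (fps_deriv f)))
     - fps_const (1 + a) * (fps_X * (fps_X * fps_deriv (fps_deriv f)))
     + fps_const a * (fps_X * fps_deriv (fps_deriv f))
     + fps_const (\<alpha> + \<beta> + 1) * (fps_X * (fps_X * fps_deriv f))
     - fps_const (\<gamma> * (1 + a) + a * \<delta> + (\<alpha> + \<beta> - \<gamma> - \<delta> + 1)) * (fps_X * fps_deriv f)
     + fps_const (\<gamma> * a) * fps_deriv f
     + fps_const (\<alpha> * \<beta>) * (fps_X * f) - fps_const q * f"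
    unfolding heun_fps_op_def
    by (simp add: algebra_simps flip: fps_const_add fps_const_sub fps_const_mult)
  show "fps_nth (heun_fps_op a q \<alpha> \<beta> \<gamma> \<delta> f) 0 = \<gamma> * a * fps_nth f 1 - q * fps_nth f 0"
    unfolding expand by simp
  show "fps_nth (heun_fps_op a q \<alpha> \<beta> \<gamma> \<delta> f) (Suc n) =
     (\<alpha> + of_nat n) * (\<beta> + of_nat n) * fps_nth f n
     - (of_nat (Suc n) * ((\<gamma> + of_nat n) * (1 + a) + a * \<delta> + (\<alpha> + \<beta> - \<gamma> - \<delta> + 1)) + q)
       * fps_nth f (Suc n)
     + a * of_nat (Suc (Suc n)) * (\<gamma> + of_nat (Suc n)) * fps_nth f (Suc (Suc n))"
  proof (cases n)
    case 0
    thus ?thesis unfolding expand by (simp add: algebra_simps)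
  next
    case (Suc m)
    thus ?thesis
      unfolding expand by (cases m) (simp_all add: algebra_simps)
  qed
qed

text \<open>
  The leading factor \<open>a * (n + 1) * (\<gamma> + n)\<close> of the recurrence never vanishes: the exponents at the
  origin are 0 and \<open>1 - \<gamma>\<close>, and the second is not a positive integer.
\<close>
lemma heun_fps_unique:
  assumes "a \<noteq> 0" "\<gamma> \<notin> \<int>\<^sub>\<le>\<^sub>0"
    and f: "heun_fps_op a q \<alpha> \<beta> \<gamma> \<delta> f = 0" and g: "heun_fps_op a q \<alpha> \<beta> \<gamma> \<delta> g = 0"
    and init: "fps_nth f 0 = fps_nth g 0"
  shows "f = g"
proof -
  have nz: "\<gamma> + of_nat n \<noteq> 0" for n
    using assms(2) by (metis plus_of_nat_eq_0_imp)
  have "\<gamma> * a * fps_nth f 1 = \<gamma> * a * fps_nth g 1"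
    using heun_fps_op_nth(1)[of a q \<alpha> \<beta> \<gamma> \<delta> f] heun_fps_op_nth(1)[of a q \<alpha> \<beta> \<gamma> \<delta> g]
      f g init by simp
  hence one: "fps_nth f 1 = fps_nth g 1"
    using assms(1) nz[of 0] by simp
  have "fps_nth f n = fps_nth g n \<and> fps_nth f (Suc n) = fps_nth g (Suc n)" for n
  proof (induction n)
    case 0
    show ?case using init one by simp
  next
    case (Suc n)
    have "a * of_nat (Suc (Suc n)) * (\<gamma> + of_nat (Suc n)) \<noteq> 0"
      using assms(1) nz[of "Suc n"] by (simp del: of_nat_Suc)
    moreover have "a * of_nat (Suc (Suc n)) * (\<gamma> + of_nat (Suc n)) * fps_nth f (Suc (Suc n))
        = a * of_nat (Suc (Suc n)) * (\<gamma> + of_nat (Suc n)) * fps_nth g (Suc (Suc n))"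
      using heun_fps_op_nth(2)[of a q \<alpha> \<beta> \<gamma> \<delta> f n] heun_fps_op_nth(2)[of a q \<alpha> \<beta> \<gamma> \<delta> g n]
        f g Suc by (simp del: of_nat_Suc add: algebra_simps)
    ultimately show ?case using Suc by (metis mult_left_cancel)
  qed
  thus ?thesis by (simp add: fps_eq_iff)
qed

lemma Hl_eqI:
  assumes a: "a \<noteq> 0" and \<gamma>: "\<gamma> \<notin> \<int>\<^sub>\<le>\<^sub>0"
    and f: "heun_fps_op a q \<alpha> \<beta> \<gamma> \<delta> f = 0" "fps_nth f 0 = 1" "fps_conv_radius f > 0"
  shows "Hl a q \<alpha> \<beta> \<gamma> \<delta> = eval_fps f"
proof -
  have exp: "eval_fps f has_fps_expansion f"
    using f(3) by (rule eval_fps_has_fps_expansion)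
  have "eval_fps f analytic_on {0}"
    using f(3) by (intro analytic_on_eval_fps) (auto simp: zero_ereal_def)
  hence sol: "heun_local_solution a q \<alpha> \<beta> \<gamma> \<delta> (eval_fps f)"
    using f(1,2) eventually_heun_eq_iff_fps[OF exp a]
    by (simp add: heun_local_solution_def eval_fps_at_0)
  have "(THE g. \<exists>F. heun_local_solution a q \<alpha> \<beta> \<gamma> \<delta> F \<and> F has_fps_expansion g) = f"
  proof (rule the_equality)
    show "\<exists>F. heun_local_solution a q \<alpha> \<beta> \<gamma> \<delta> F \<and> F has_fps_expansion f"
      using sol exp by blast
  next
    fix g assume "\<exists>F. heun_local_solution a q \<alpha> \<beta> \<gamma> \<delta> F \<and> F has_fps_expansion g"
    then obtain F where F: "heun_local_solution a q \<alpha> \<beta> \<gamma> \<delta> F" "F has_fps_expansion g"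
      by blast
    have "heun_fps_op a q \<alpha> \<beta> \<gamma> \<delta> g = 0"
      using F eventually_heun_eq_iff_fps[OF F(2) a] by (simp add: heun_local_solution_def)
    moreover have "fps_nth g 0 = 1"
      using F fps_nth_fps_expansion[OF F(2), of 0] by (simp add: heun_local_solution_def)
    ultimately show "g = f"
      using heun_fps_unique[OF a \<gamma> _ f(1)] f(2) by simp
  qed
  thus ?thesis by (simp add: Hl_def)
qed

lemma tendsto_add_of_nat_ratio:
  "(\<lambda>n. (a + of_nat n) / (b + of_nat n)) \<longlonglongrightarrow> (1 :: complex)"
proof -
  have "(\<lambda>n. (a / of_nat n + 1) / (b / of_nat n + 1)) \<longlonglongrightarrow> (0 + 1) / (0 + 1 :: complex)"
    by (intro tendsto_intros lim_const_over_n) auto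
  moreover have "\<forall>\<^sub>F n in sequentially.
      (a / of_nat n + 1) / (b / of_nat n + 1) = (a + of_nat n) / (b + of_nat n)"
    using eventually_gt_at_top[of 0]
  proof eventually_elim
    case (elim n)
    hence "a / of_nat n + 1 = (a + of_nat n) / of_nat n" "b / of_nat n + 1 = (b + of_nat n) / of_nat n"
      by (simp_all add: field_simps)
    thus ?case using elim by simp
  qed
  ultimately show ?thesis
    using Lim_transform_eventually by fastforce
qed

text \<open>
  The ratios of consecutive coefficients tend to 1.  The argument bounds terms instead of taking a
  limit of quotients, because the series may terminate and its coefficients may then be 0.
\<close>
lemma fps_conv_radius_hypergeo_3_2_pos:
  "fps_conv_radius (fps_hypergeo [a1, a2, a3 :: complex] [b1, b2] 1) > 0"
proof -
  define f where "f = fps_hypergeo [a1, a2, a3] [b1, b2] 1"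
  define r where "r n = (a1 + of_nat n) / (1 + of_nat n) *
     ((a2 + of_nat n) / (b1 + of_nat n)) * ((a3 + of_nat n) / (b2 + of_nat n))" for n
  have rec: "fps_nth f (Suc n) = r n * fps_nth f n" for n
    unfolding f_def fps_hypergeo_rec r_def
    by (simp del: fps_hypergeo_nth add: mult_ac add.commute)
  have "r \<longlonglongrightarrow> 1 * 1 * 1"
    unfolding r_def by (intro tendsto_mult tendsto_add_of_nat_ratio)
  hence "(\<lambda>n. norm (r n)) \<longlonglongrightarrow> norm (1 * 1 * 1 :: complex)"
    by (rule tendsto_norm)
  hence "\<forall>\<^sub>F n in sequentially. norm (r n) < 2"
    by (rule order_tendstoD(2)) simp
  then obtain N where N: "norm (r n) < 2" if "n \<ge> N" for n
    unfolding eventually_sequentially by blast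
  \<comment> \<open>At \<open>1/4\<close> the factor 2 leaves a ratio of at most \<open>1/2\<close> between consecutive terms.\<close>
  have "summable (\<lambda>n. fps_nth f n * (1/4) ^ n)"
  proof (rule summable_ratio_test[of "1/2"])
    fix n assume "N \<le> n"
    hence "norm (r n) * (norm (fps_nth f n) * (1/4) ^ n / 4)
           \<le> 2 * (norm (fps_nth f n) * (1/4) ^ n / 4)"
      using N[of n] by (intro mult_right_mono) auto
    thus "norm (fps_nth f (Suc n) * (1/4) ^ Suc n) \<le> 1/2 * norm (fps_nth f n * (1/4) ^ n)"
      by (simp add: rec norm_mult norm_power norm_divide mult_ac)
  qed auto
  hence "ereal (norm (1/4 :: complex)) \<le> fps_conv_radius f"
    unfolding fps_conv_radius_def by (rule conv_radius_geI)
  moreover have "0 < ereal (norm (1/4 :: complex))"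
    by simp
  ultimately show ?thesis
    unfolding f_def by (rule less_le_trans[rotated])
qed

text \<open>
  The hypotheses on \<open>a\<close> and \<open>q\<close> are the defining formulas of the Heun parameters of \<open>G\<close>, with
  \<open>q\<close> expressed through \<open>a\<close>.  The choice \<open>\<delta> = \<alpha> + \<beta> - \<gamma> + 2\<close> amounts to \<open>\<epsilon> = -1\<close>.
\<close>
lemma heun_fps_op_hypergeo_3_2:
  assumes a: "a * ((e - \<alpha>) * (e - \<beta>)) = e * (e - \<gamma> + 1)"
    and q: "q * e = a * \<alpha> * \<beta> * (e + 1)"
    and \<gamma>: "\<gamma> \<notin> \<int>\<^sub>\<le>\<^sub>0" and e: "e \<notin> \<int>\<^sub>\<le>\<^sub>0"
  shows "heun_fps_op a q \<alpha> \<beta> \<gamma> (\<alpha> + \<beta> - \<gamma> + 2) (fps_hypergeo [\<alpha>, \<beta>, e + 1] [\<gamma>, e] 1) = 0"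
proof -
  define f where "f = fps_hypergeo [\<alpha>, \<beta>, e + 1] [\<gamma>, e] 1"
  define c where "c = fps_nth (fps_hypergeo [\<alpha>, \<beta>] [\<gamma>] 1)"
  have e0: "e \<noteq> 0" using e by auto
  have nz: "\<gamma> + of_nat n \<noteq> 0" for n
    using \<gamma> by (metis plus_of_nat_eq_0_imp)
  have c_Suc: "of_nat (Suc n) * (\<gamma> + of_nat n) * c (Suc n) = (\<alpha> + of_nat n) * (\<beta> + of_nat n) * c n" for n
    unfolding c_def fps_hypergeo_rec using nz[of n] by (simp del: of_nat_Suc fps_hypergeo_nth)
  have f_c: "e * fps_nth f n = c n * (e + of_nat n)" for n
  proof -
    have "pochhammer e n \<noteq> 0"
      using e by (metis pochhammer_eq_0_imp_nonpos_Int)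
    moreover have "e * pochhammer (e + 1) n = pochhammer e n * (e + of_nat n)"
      by (metis pochhammer_Suc pochhammer_rec)
    ultimately show ?thesis
      by (simp add: f_def c_def divide_simps)
  qed
  \<comment> \<open>This is the polynomial left over once the common factor \<open>c n\<close> is removed from the recurrence.
    Modulo the relation for \<open>q\<close>, its product with \<open>e\<close> is
    \<open>m * (e * (e - \<gamma> + 1) - a * (e - \<alpha>) * (e - \<beta>))\<close>.\<close>
  have cancel: "e * (m * (\<gamma> + m - 1) * (e + m - 1)
      - (m * ((\<gamma> + m - 1) * (1 + a) + a * (\<alpha> + \<beta> - \<gamma> + 2) - 1) + q) * (e + m)
      + a * (\<alpha> + m) * (\<beta> + m) * (e + m + 1)) = 0" for m
    using a q by algebra
  have "fps_nth (heun_fps_op a q \<alpha> \<beta> \<gamma> (\<alpha> + \<beta> - \<gamma> + 2) f) n = 0" for n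
  proof (cases n)
    case 0
    have c1: "\<gamma> * c 1 = \<alpha> * \<beta> * c 0"
      using c_Suc[of 0] by simp
    have "e * e * (\<gamma> * a * fps_nth f 1 - q * fps_nth f 0)
      = e * \<gamma> * a * (e * fps_nth f 1) - e * q * (e * fps_nth f 0)"
      by (simp add: algebra_simps)
    also have "\<dots> = 0"
      using c1 q unfolding f_c of_nat_1 of_nat_0 by algebra
    finally show ?thesis
      using e0 0 by (simp add: heun_fps_op_nth(1) del: One_nat_def)
  next
    case (Suc k)
    define m :: complex where "m = of_nat (Suc k)"
    have k: "of_nat k = m - 1" "of_nat (Suc (Suc k)) = m + 1"
      by (simp_all add: m_def)
    have "e * fps_nth (heun_fps_op a q \<alpha> \<beta> \<gamma> (\<alpha> + \<beta> - \<gamma> + 2) f) (Suc k)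
      = (\<alpha> + (m - 1)) * (\<beta> + (m - 1)) * (e * fps_nth f k)
        - (m * ((\<gamma> + m - 1) * (1 + a) + a * (\<alpha> + \<beta> - \<gamma> + 2) - 1) + q) * (e * fps_nth f (Suc k))
        + a * (m + 1) * (\<gamma> + m) * (e * fps_nth f (Suc (Suc k)))"
      unfolding heun_fps_op_nth(2) k m_def[symmetric] by (simp add: algebra_simps)
    also have "\<dots> = ((\<alpha> + (m - 1)) * (\<beta> + (m - 1)) * c k) * (e + m - 1)
        - (m * ((\<gamma> + m - 1) * (1 + a) + a * (\<alpha> + \<beta> - \<gamma> + 2) - 1) + q) * (c (Suc k) * (e + m))
        + a * ((m + 1) * (\<gamma> + m) * c (Suc (Suc k))) * (e + m + 1)"
      unfolding f_c k m_def[symmetric] by (simp add: algebra_simps)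
    also have "\<dots> = c (Suc k) * (m * (\<gamma> + m - 1) * (e + m - 1)
        - (m * ((\<gamma> + m - 1) * (1 + a) + a * (\<alpha> + \<beta> - \<gamma> + 2) - 1) + q) * (e + m)
        + a * (\<alpha> + m) * (\<beta> + m) * (e + m + 1))"
      using c_Suc[of k] c_Suc[of "Suc k"] unfolding k m_def[symmetric] by algebra
    also have "\<dots> = 0"
      using cancel[of m] e0 by (metis mult_eq_0_iff)
    finally show ?thesis using e0 Suc by simp
  qed
  thus ?thesis by (simp add: f_def fps_eq_iff del: fps_hypergeo_nth)
qed

theorem theorem5p3:
  fixes \<alpha> \<beta> \<gamma> e :: complex
  assumes "(e - \<alpha>) * (e - \<beta>) \<noteq> 0"
    and "G_sing \<alpha> \<beta> \<gamma> e \<noteq> 0" and "G_sing \<alpha> \<beta> \<gamma> e \<noteq> 1"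
    and "\<gamma> \<notin> \<int>\<^sub>\<le>\<^sub>0" and "e \<notin> \<int>\<^sub>\<le>\<^sub>0"
  shows "\<forall>\<^sub>F x in nhds 0. heun_G \<alpha> \<beta> \<gamma> e x = hyp3F2 \<alpha> \<beta> (e + 1) \<gamma> e x"
proof -
  have "G_sing \<alpha> \<beta> \<gamma> e * ((e - \<alpha>) * (e - \<beta>)) = e * (e - \<gamma> + 1)"
    using assms(1) unfolding G_sing_def by simp
  moreover have "G_acc \<alpha> \<beta> \<gamma> e * e = G_sing \<alpha> \<beta> \<gamma> e * \<alpha> * \<beta> * (e + 1)"
    unfolding G_acc_def G_sing_def by (simp add: mult_ac)
  ultimately have "Hl (G_sing \<alpha> \<beta> \<gamma> e) (G_acc \<alpha> \<beta> \<gamma> e) \<alpha> \<beta> \<gamma> (\<alpha> + \<beta> - \<gamma> + 2) =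
      eval_fps (fps_hypergeo [\<alpha>, \<beta>, e + 1] [\<gamma>, e] 1)"
    using assms(2,4,5)
    by (intro Hl_eqI heun_fps_op_hypergeo_3_2 fps_conv_radius_hypergeo_3_2_pos) auto
  thus ?thesis
    by (simp add: heun_G_def hyp3F2_def)
qed

end
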